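(* Let $n\ge1$ and fix a Dyck path $\beta$ of length $2n+2$. The number of permutations $w\in\mathfrak{S}_{2n}$ with $p_B(w)=\beta$ equals \[1\cdot3\cdot5\cdots(2n-1)\prod_{i=1}^n h_i^*(\beta).\]
   Context: A Dyck path of length $2N$ is a lattice path from $(0,0)$ to $(2N,0)$ with steps $(1,1)$ (up) and $(1,-1)$ (down) staying weakly above the $x$-axis; the down step ending at $x$-coordinate $k$ and going from height $h$ to $h-1$ is at position $k$ with height $h$; the path is determined by its set of down-step positions. $h_i(p)$ is the height of the $i$th down step of $p$, and $h_i^*(p)=h_i(p)-1$ if there is no up step to the right of the $i$th down step, $h_i^*(p)=h_i(p)$ otherwise. Crossout procedure: for $w\in\mathfrak{S}_{2n}$ in one-line notation, repeat until all positions are marked: mark "B" at the unmarked position $i$ with smallest value $w(i)$, then mark "A" at the leftmost unmarked position. $\mathcal{B}(w)$ is the set of positions marked B. $p_B(w)$ is the Dyck path of length $2n+2$ whose down-step positions are $\{b+1:b\in\mathcal{B}(w)\}\cup\{2n+2\}$. *)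

theory Defs
  imports "HOL-Combinatorics.Permutations"
begin

datatype step = Up | Down

text \<open>A lattice path starting at the origin is the list of its steps; the step ending at
  x-coordinate \<open>k\<close> has list index \<open>k - 1\<close>.\<close>

definition path_height :: "step list \<Rightarrow> nat \<Rightarrow> int" where
  "path_height p k = (\<Sum>j<k. if p ! j = Up then 1 else - 1)"

definition dyck_path :: "nat \<Rightarrow> step list \<Rightarrow> bool" where
  "dyck_path N p \<longleftrightarrow>
     length p = 2 * N \<and> (\<forall>k\<le>2 * N. 0 \<le> path_height p k) \<and> path_height p (2 * N) = 0"

definition down_positions :: "step list \<Rightarrow> nat set" where
  "down_positions p = {k \<in> {1..length p}. p ! (k - 1) = Down}"

definition path_of_downs :: "nat \<Rightarrow> nat set \<Rightarrow> step list" where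
  "path_of_downs l D = map (\<lambda>k. if k \<in> D then Down else Up) [1..<l + 1]"

lemma length_path_of_downs [simp]: "length (path_of_downs l D) = l"
  by (simp add: path_of_downs_def)

lemma down_positions_path_of_downs:
  assumes "D \<subseteq> {1..l}"
  shows "down_positions (path_of_downs l D) = D"
proof -
  have "path_of_downs l D ! (k - 1) = (if k \<in> D then Down else Up)" if "k \<in> {1..l}" for k
    using that by (auto simp: path_of_downs_def simp del: upt_Suc)
  then show ?thesis
    using assms by (auto simp: down_positions_def split: if_splits)
qed

definition down_pos :: "step list \<Rightarrow> nat \<Rightarrow> nat" where
  "down_pos p i = sorted_list_of_set (down_positions p) ! (i - 1)"

definition down_height :: "step list \<Rightarrow> nat \<Rightarrow> int" where
  "down_height p i = path_height p (down_pos p i - 1)"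

definition down_height_star :: "step list \<Rightarrow> nat \<Rightarrow> int" where
  "down_height_star p i =
     (if \<exists>k\<in>{1..length p}. down_pos p i < k \<and> p ! (k - 1) = Up
      then down_height p i else down_height p i - 1)"

text \<open>\<open>crossout_B w U\<close> is the set of positions that receive the mark B when the crossout
  procedure is run from the state whose set of unmarked positions is \<open>U\<close>: one round marks
  B at \<open>arg_min_on w U\<close>, then A at the least remaining position.\<close>

function crossout_B :: "(nat \<Rightarrow> nat) \<Rightarrow> nat set \<Rightarrow> nat set" where
  "crossout_B w U =
     (if finite U \<and> U \<noteq> {} then
        let b = arg_min_on w U; a = Min (U - {b})
        in insert b (crossout_B w (U - {b, a}))
      else {})"
  by pat_completeness auto
termination
proof (relation "measure (\<lambda>(w, U). card U)", goal_cases)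
  case (2 w U b a)
  then have "b \<in> U"
    by (simp add: arg_min_if_finite)
  then show ?case
    using 2 by (auto intro!: psubset_card_mono)
qed simp

declare crossout_B.simps [simp del]

definition B_set :: "nat \<Rightarrow> (nat \<Rightarrow> nat) \<Rightarrow> nat set" where
  "B_set n w = crossout_B w {1..2 * n}"

definition p_B :: "nat \<Rightarrow> (nat \<Rightarrow> nat) \<Rightarrow> step list" where
  "p_B n w = path_of_downs (2 * n + 2) ((\<lambda>b. b + 1) ` B_set n w \<union> {2 * n + 2})"

end

theory Submission
  imports Defs "HOL-Combinatorics.Multiset_Permutations"
begin

text \<open>The first round of the crossout procedure marks some \<open>b\<close> with B and some \<open>a\<close> with A. Given \<open>b\<close>,
  the relative order of the other \<open>2n - 2\<close> positions is arbitrary and the value at \<open>a\<close> can be inserted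
  in \<open>2n - 1\<close> ways; this yields the double factorial, and leaves a sum over \<open>b\<close>.
  If the first position is marked B, then it has to be \<open>b\<close>, and deleting \<open>b\<close> and \<open>a\<close> does not change
  any other height. If not, then \<open>b\<close> is an arbitrary down step, and deleting the first up step and \<open>b\<close>
  lowers exactly the heights of the down steps before \<open>b\<close>. With \<open>x\<^sub>i = h\<^sub>i\<^sup>*\<close>, the sum over \<open>j\<close> of
  \<open>\<Prod>\<^bsub>i<j\<^esub> (x\<^sub>i - 1) \<Prod>\<^bsub>i>j\<^esub> x\<^sub>i\<close> telescopes to \<open>\<Prod> x\<^sub>i - \<Prod> (x\<^sub>i - 1)\<close>, and the last product
  vanishes because some starred height is 1. Sets of down steps that cross below the axis need no
  separate treatment: both sides are then 0.\<close>

section \<open>Permutations as lists\<close>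

lemma bij_betw_inv_permutes: "bij_betw inv {w. w permutes S} {w. w permutes S}"
  by (rule bij_betwI[of _ _ _ inv]) (auto simp: permutes_inv permutes_inv_inv)

lemma bij_betw_map_permutations_of_set:
  assumes "distinct xs"
  shows "bij_betw (\<lambda>w. map w xs) {w. w permutes set xs} (permutations_of_set (set xs))"
proof (rule bij_betw_imageI)
  show inj: "inj_on (\<lambda>w. map w xs) {w. w permutes set xs}"
  proof (rule inj_onI, rule ext)
    fix v w x
    assume "v \<in> {w. w permutes set xs}" "w \<in> {w. w permutes set xs}" "map v xs = map w xs"
    then show "v x = w x"
      by (cases "x \<in> set xs") (auto simp: permutes_not_in)
  qed
  show "(\<lambda>w. map w xs) ` {w. w permutes set xs} = permutations_of_set (set xs)"
  proof (rule card_subset_eq)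
    show "(\<lambda>w. map w xs) ` {w. w permutes set xs} \<subseteq> permutations_of_set (set xs)"
      using assms by (auto simp: permutations_of_set_def permutes_image distinct_map permutes_inj_on)
    show "card ((\<lambda>w. map w xs) ` {w. w permutes set xs}) = card (permutations_of_set (set xs))"
      using inj by (simp add: card_image card_permutations)
  qed simp
qed

lemma remove1_eq_iff_in_shuffles:
  assumes "distinct zs" "a \<in> set zs"
  shows "remove1 a zs = ys \<longleftrightarrow> a \<notin> set ys \<and> zs \<in> shuffles [a] ys"
proof
  have remove1_eq_filter: "remove1 a zs = filter (\<lambda>x. x \<notin> set [a]) zs"
    using assms by (simp add: distinct_remove1_removeAll removeAll_filter_not_eq eq_commute)
  show "a \<notin> set ys \<and> zs \<in> shuffles [a] ys" if "remove1 a zs = ys"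
  proof -
    have "filter (\<lambda>x. x \<in> set [a]) zs = [a]"
      using assms by (induction zs) (auto simp: filter_empty_conv)
    then show ?thesis
      using partition_in_shuffles[of zs "\<lambda>x. x \<in> set [a]"] that remove1_eq_filter by auto
  qed
  show "remove1 a zs = ys" if "a \<notin> set ys \<and> zs \<in> shuffles [a] ys"
    using that filter_shuffles_disjoint1(2)[of "[a]" ys zs] remove1_eq_filter by simp
qed

lemma permutations_of_set_remove1_eq_shuffles:
  assumes "a \<in> V" "ys \<in> permutations_of_set (V - {a})"
  shows "{zs \<in> permutations_of_set V. remove1 a zs = ys} = shuffles [a] ys"
proof -
  have set_ys: "set ys = V - {a}" and "distinct ys"
    using assms(2) by (auto simp: permutations_of_set_def)
  have "zs \<in> permutations_of_set V" if "zs \<in> shuffles [a] ys" for zs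
    using that set_ys \<open>distinct ys\<close> assms(1) set_shuffles[OF that]
      distinct_disjoint_shuffles[of "[a]" ys zs]
    by (auto simp: permutations_of_set_def)
  moreover have "remove1 a zs = ys \<longleftrightarrow> zs \<in> shuffles [a] ys" if "zs \<in> permutations_of_set V" for zs
    using set_ys assms(1) permutations_of_setD[OF that] by (simp add: remove1_eq_iff_in_shuffles)
  ultimately show ?thesis by blast
qed

lemma card_permutations_of_set_remove1:
  assumes "finite V" "a \<in> V" "Y \<subseteq> permutations_of_set (V - {a})"
  shows "card {zs \<in> permutations_of_set V. remove1 a zs \<in> Y} = card V * card Y"
proof -
  have card_fibre: "card (shuffles [a] ys) = card V" if "ys \<in> permutations_of_set (V - {a})" for ys
  proof -
    have "set ys = V - {a}" "distinct ys"
      using that by (auto simp: permutations_of_set_def)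
    moreover from this have "Suc (length ys) = card V"
      using assms(1,2) by (metis card_Suc_Diff1 distinct_card)
    ultimately show ?thesis
      by (simp add: card_disjoint_shuffles)
  qed
  have "{zs \<in> permutations_of_set V. remove1 a zs \<in> Y}
      = (\<Union>ys\<in>Y. {zs \<in> permutations_of_set V. remove1 a zs = ys})"
    by auto
  also have "card \<dots> = (\<Sum>ys\<in>Y. card {zs \<in> permutations_of_set V. remove1 a zs = ys})"
    using finite_subset[OF assms(3)] by (intro card_UN_disjoint) auto
  also have "\<dots> = (\<Sum>ys\<in>Y. card V)"
    using assms(2,3)
    by (intro sum.cong refl)
      (simp add: subset_iff permutations_of_set_remove1_eq_shuffles card_fibre)
  finally show ?thesis by simp
qed

section \<open>Counting by the first round of the crossout procedure\<close>

lemma crossout_B_subset: "crossout_B w U \<subseteq> U"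
proof (induction w U rule: crossout_B.induct)
  case (1 w U)
  show ?case
  proof (cases "finite U \<and> U \<noteq> {}")
    case True
    then have "arg_min_on w U \<in> U" by (simp add: arg_min_if_finite)
    then show ?thesis
      using 1[OF True refl refl] True by (subst crossout_B.simps) (auto simp: Let_def)
  qed (subst crossout_B.simps; auto)
qed

text \<open>Only the order of the values of \<open>w\<close> matters to the procedure, so \<open>w\<close> is replaced by the list
  of its positions in increasing order of value.\<close>

function crossout_list :: "'a::linorder list \<Rightarrow> 'a set" where
  "crossout_list [] = {}"
| "crossout_list (b # zs) = insert b (crossout_list (remove1 (Min (set zs)) zs))"
  by pat_completeness auto
termination
  by (relation "measure length") (auto simp: length_remove1)

lemma crossout_list_subset: "crossout_list xs \<subseteq> set xs"
proof (induction xs rule: crossout_list.induct[case_names Nil Cons])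
  case (Cons b zs)
  then show ?case
    using set_remove1_subset[of "Min (set zs)" zs] by auto
qed simp

lemma crossout_B_eq_crossout_list:
  assumes "sorted_wrt (<) (map w xs)"
  shows "crossout_B w (set xs) = crossout_list xs"
  using assms
proof (induction xs rule: crossout_list.induct[case_names Nil Cons])
  case Nil
  then show ?case by (simp add: crossout_B.simps)
next
  case (Cons b zs)
  let ?a = "Min (set zs)"
  have "inj_on w (set (b # zs))" and distinct: "distinct (b # zs)"
    using Cons.prems by (simp_all only: strict_sorted_iff distinct_map)
  then have arg_min: "arg_min_on w (set (b # zs)) = b"
    unfolding arg_min_on_def using Cons.prems
    by (intro arg_min_inj_eq) (simp_all only: Collect_mem_eq, auto intro: less_imp_le)
  have "sorted_wrt (<) (map w (remove1 ?a zs))"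
    using Cons.prems by (auto simp: strict_sorted_iff distinct_map sorted_map_remove1
        intro: inj_on_diff)
  then have "crossout_B w (set (remove1 ?a zs)) = crossout_list (remove1 ?a zs)"
    by (rule Cons.IH)
  moreover have "set (b # zs) - {b} = set zs" "set (b # zs) - {b, ?a} = set (remove1 ?a zs)"
    using distinct by auto
  ultimately show ?case
    by (subst crossout_B.simps) (simp add: Let_def arg_min del: set_simps)
qed

definition crossout_count :: "'a::linorder set \<Rightarrow> 'a set \<Rightarrow> nat" where
  "crossout_count U B = card {xs \<in> permutations_of_set U. crossout_list xs = B}"

lemma card_permutes_B_set:
  "card {w. w permutes {1..2 * n} \<and> B_set n w = B} = crossout_count {1..2 * n} B"
proof -
  let ?xs = "[1..<2 * n + 1]"
  have set_xs: "set ?xs = {1..2 * n}" by auto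
  have B_set_eq: "B_set n w = crossout_list (map (inv w) ?xs)" if w: "w permutes {1..2 * n}" for w
  proof -
    have "map w (map (inv w) ?xs) = ?xs"
      using permutes_inverses(1)[OF w] by (simp add: comp_def del: upt_Suc)
    moreover have "set (map (inv w) ?xs) = {1..2 * n}"
      using set_xs permutes_image[OF permutes_inv[OF w]] by (simp only: set_map)
    ultimately show ?thesis
      using crossout_B_eq_crossout_list[of w "map (inv w) ?xs"]
      by (simp add: B_set_def del: upt_Suc set_map map_map)
  qed
  have "bij_betw (\<lambda>w. map (inv w) ?xs) {w. w permutes {1..2 * n}} (permutations_of_set {1..2 * n})"
    using bij_betw_trans[OF bij_betw_inv_permutes bij_betw_map_permutations_of_set[of ?xs]]
    by (simp only: set_xs distinct_upt comp_def)
  then have "bij_betw (\<lambda>w. map (inv w) ?xs) {w \<in> {w. w permutes {1..2 * n}}. B_set n w = B}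
      {xs \<in> permutations_of_set {1..2 * n}. crossout_list xs = B}"
    by (rule bij_betw_Collect) (simp add: B_set_eq del: upt_Suc)
  then show ?thesis
    unfolding crossout_count_def by (auto dest: bij_betw_same_card)
qed

definition A_mark :: "'a::linorder set \<Rightarrow> 'a \<Rightarrow> 'a" where
  "A_mark U b = Min (U - {b})"

lemma A_mark_in:
  assumes "finite U" "card U \<ge> 2"
  shows "A_mark U b \<in> U - {b}"
proof -
  have "\<not> U \<subseteq> {b}"
    using assms(2) card_mono[of "{b}" U] by auto
  then show ?thesis
    unfolding A_mark_def using assms(1) by (intro Min_in) auto
qed

lemma A_mark_eq_Min:
  assumes "finite U" "U \<noteq> {}" "b \<noteq> Min U"
  shows "A_mark U b = Min U"
  unfolding A_mark_def using assms by (intro Min_eqI) auto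

definition after_round :: "'a::linorder set \<Rightarrow> 'a \<Rightarrow> 'a set" where
  "after_round U b = U - {b, A_mark U b}"

lemma finite_after_round [simp]: "finite U \<Longrightarrow> finite (after_round U b)"
  by (simp add: after_round_def)

lemma card_after_round:
  assumes "finite U" "card U \<ge> 2" "b \<in> U"
  shows "card (after_round U b) = card U - 2"
  unfolding after_round_def using assms A_mark_in[OF assms(1,2), of b]
  by (subst card_Diff_subset) auto

definition first_B_marks :: "'a::linorder set \<Rightarrow> 'a set \<Rightarrow> 'a set" where
  "first_B_marks U B = {b \<in> B. A_mark U b \<notin> B}"

lemma first_B_marks_eq_self:
  assumes "finite U" "U \<noteq> {}" "Min U \<notin> B"
  shows "first_B_marks U B = B"
proof -
  have "A_mark U b = Min U" if "b \<in> B" for b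
    using that assms by (intro A_mark_eq_Min) auto
  then show ?thesis
    using assms(3) by (auto simp: first_B_marks_def)
qed

lemma first_B_marks_eq_Min:
  assumes "finite U" "U \<noteq> {}" "Min U \<in> B"
  shows "first_B_marks U B = (if A_mark U (Min U) \<in> B then {} else {Min U})"
proof -
  have "A_mark U b \<in> B" if "b \<noteq> Min U" for b
    using that assms by (simp add: A_mark_eq_Min)
  then show ?thesis
    unfolding first_B_marks_def using assms(3) by (cases "A_mark U (Min U) \<in> B") force+
qed

lemma crossout_list_Cons_eq_iff:
  assumes "finite U" "card U \<ge> 2" "b \<in> B" "zs \<in> permutations_of_set (U - {b})"
  shows "crossout_list (b # zs) = B \<longleftrightarrow>
    A_mark U b \<notin> B \<and> remove1 (A_mark U b) zs \<in> permutations_of_set (after_round U b) \<and>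
    crossout_list (remove1 (A_mark U b) zs) = B - {b}"
proof -
  let ?zs = "remove1 (A_mark U b) zs"
  have "set zs = U - {b}" "distinct zs"
    using assms(4) by (auto simp: permutations_of_set_def)
  then have perm: "?zs \<in> permutations_of_set (after_round U b)"
    and crossout_Cons: "crossout_list (b # zs) = insert b (crossout_list ?zs)"
    by (auto simp: permutations_of_set_def A_mark_def after_round_def)
  have "crossout_list ?zs \<subseteq> after_round U b"
    using perm crossout_list_subset by (auto simp: permutations_of_set_def)
  then show ?thesis
    unfolding crossout_Cons using perm A_mark_in[OF assms(1,2), of b] assms(3)
    by (auto simp: after_round_def)
qed

lemma card_crossout_list_Cons:
  assumes "finite U" "card U \<ge> 2" "b \<in> U" "b \<in> B"
  shows "card {zs \<in> permutations_of_set (U - {b}). crossout_list (b # zs) = B} =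
    (if A_mark U b \<in> B then 0
     else (card U - 1) * crossout_count (after_round U b) (B - {b}))"
proof (cases "A_mark U b \<in> B")
  case True
  then have "{zs \<in> permutations_of_set (U - {b}). crossout_list (b # zs) = B} = {}"
    using crossout_list_Cons_eq_iff[OF assms(1,2,4)] by blast
  then show ?thesis using True by simp
next
  case False
  let ?Y = "{ys \<in> permutations_of_set (after_round U b). crossout_list ys = B - {b}}"
  have "{zs \<in> permutations_of_set (U - {b}). crossout_list (b # zs) = B}
      = {zs \<in> permutations_of_set (U - {b}). remove1 (A_mark U b) zs \<in> ?Y}"
    using False crossout_list_Cons_eq_iff[OF assms(1,2,4)] by blast
  moreover have "card \<dots> = card (U - {b}) * card ?Y"
  proof (rule card_permutations_of_set_remove1)
    show "?Y \<subseteq> permutations_of_set (U - {b} - {A_mark U b})"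
      by (auto simp: after_round_def Diff_insert2[symmetric] insert_commute)
  qed (use assms(1,2) A_mark_in in auto)
  ultimately show ?thesis
    using False assms by (simp add: crossout_count_def)
qed

lemma crossout_count_rec:
  assumes "finite U" "B \<subseteq> U" "card U \<ge> 2"
  shows "crossout_count U B =
    (card U - 1) * (\<Sum>b\<in>first_B_marks U B. crossout_count (after_round U b) (B - {b}))"
proof -
  let ?Z = "\<lambda>b. {zs \<in> permutations_of_set (U - {b}). crossout_list (b # zs) = B}"
  have "finite B" "U \<noteq> {}"
    using assms finite_subset by auto
  then have "{xs \<in> permutations_of_set U. crossout_list xs = B} = (\<Union>b\<in>B. (#) b ` ?Z b)"
    using assms(2) by (auto simp: permutations_of_set_nonempty)
  then have "crossout_count U B = card (\<Union>b\<in>B. (#) b ` ?Z b)"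
    by (simp only: crossout_count_def)
  also have "\<dots> = (\<Sum>b\<in>B. card ((#) b ` ?Z b))"
    using \<open>finite B\<close> by (intro card_UN_disjoint) auto
  also have "\<dots> = (\<Sum>b\<in>B. card (?Z b))"
    by (intro sum.cong card_image) auto
  also have "\<dots> = (\<Sum>b\<in>B. if A_mark U b \<in> B then 0
      else (card U - 1) * crossout_count (after_round U b) (B - {b}))"
    using assms by (intro sum.cong card_crossout_list_Cons) auto
  also have "\<dots> = (\<Sum>b\<in>first_B_marks U B. (card U - 1) * crossout_count (after_round U b) (B - {b}))"
    using \<open>finite B\<close> by (intro sum.mono_neutral_cong_right) (auto simp: first_B_marks_def)
  finally show ?thesis
    by (simp add: sum_distrib_left)
qed

section \<open>Starred heights\<close>

definition net_rise :: "'a set \<Rightarrow> 'a set \<Rightarrow> int" where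
  "net_rise B U = (\<Sum>u\<in>U. if u \<in> B then - 1 else 1)"

lemma net_rise_insert:
  assumes "finite U" "u \<notin> U"
  shows "net_rise B (insert u U) = net_rise B U + (if u \<in> B then - 1 else 1)"
  using assms by (simp add: net_rise_def)

lemma net_rise_cong: "U \<inter> B = U \<inter> B' \<Longrightarrow> net_rise B U = net_rise B' U"
  unfolding net_rise_def by (intro sum.cong) auto

lemma net_rise_eq_card:
  assumes "finite U" "B \<subseteq> U"
  shows "net_rise B U = int (card U) - 2 * int (card B)"
proof -
  have "U \<inter> B = B" "U \<inter> - B = U - B" using assms by auto
  then show ?thesis
    using assms card_mono[OF assms]
    by (simp add: net_rise_def sum.If_cases card_Diff_subset finite_subset of_nat_diff)
qed

text \<open>\<open>U\<close> are the positions and \<open>B \<subseteq> U\<close> the down steps of a path that starts at height 1, the height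
  that a Dyck path has reached when its second step begins.\<close>

definition level :: "'a::linorder set \<Rightarrow> 'a set \<Rightarrow> 'a \<Rightarrow> int" where
  "level U B x = 1 + net_rise B {u \<in> U. u < x}"

definition star_level :: "'a::linorder set \<Rightarrow> 'a set \<Rightarrow> 'a \<Rightarrow> int" where
  "star_level U B b = (if \<exists>u\<in>U - B. b < u then level U B b else level U B b - 1)"

lemma level_Min:
  assumes "finite U"
  shows "level U B (Min U) = 1"
proof -
  have "{u \<in> U. u < Min U} = {}"
    using assms by (auto simp: not_less)
  then show ?thesis
    by (simp only: level_def net_rise_def) simp
qed

lemma level_insert_greater:
  assumes "x \<le> m"
  shows "level (insert m U) B x = level U B x"
proof -
  have "{u \<in> insert m U. u < x} = {u \<in> U. u < x}"
    using assms by auto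
  then show ?thesis by (simp add: level_def)
qed

lemma level_greatest:
  assumes "\<And>x. x \<in> U \<Longrightarrow> x < m"
  shows "level (insert m U) B m = 1 + net_rise B U"
proof -
  have "{u \<in> U. u < m} = U" using assms by auto
  then show ?thesis
    using level_insert_greater[of m m U B] by (simp add: level_def)
qed

lemma ex_level_eq_one:
  assumes "finite U" "net_rise B U < 0"
  shows "\<exists>b\<in>U \<inter> B. level U B b = 1"
  using assms
proof (induction U rule: finite_linorder_max_induct)
  case empty
  then show ?case by (simp add: net_rise_def)
next
  case (insert m U)
  then have "m \<notin> U" by auto
  then have rise: "net_rise B U + (if m \<in> B then - 1 else 1) < 0"
    using insert by (simp add: net_rise_insert)
  show ?case
  proof (cases "net_rise B U < 0")
    case True
    then obtain b where "b \<in> U \<inter> B" "level U B b = 1"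
      using insert.IH by blast
    then show ?thesis
      using insert.hyps level_insert_greater[of b m U B] by (auto intro: less_imp_le)
  next
    case False
    then have "m \<in> B" "net_rise B U = 0"
      using rise by (auto split: if_splits)
    then show ?thesis
      using insert.hyps level_greatest[of U m B] by auto
  qed
qed

text \<open>If the last step is a down step, it is a witness. Otherwise it leads from height 0 back to 1, so
  an earlier down step leads from 1 to 0.\<close>

lemma ex_star_level_eq_one:
  assumes "finite U" "U \<noteq> {}" "net_rise B U = 0"
  shows "\<exists>b\<in>U \<inter> B. star_level U B b = 1"
proof -
  define m where "m = Max U"
  define V where "V = U - {m}"
  have U_eq: "U = insert m V" and "finite V" "m \<notin> V"
    and less_m: "\<And>x. x \<in> V \<Longrightarrow> x < m"
    using Max_in[OF assms(1,2)] assms(1) by (auto simp: V_def m_def less_le)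
  have rise: "net_rise B V + (if m \<in> B then - 1 else 1) = 0"
    using assms(3) \<open>finite V\<close> \<open>m \<notin> V\<close> by (simp add: U_eq net_rise_insert)
  show ?thesis
  proof (cases "m \<in> B")
    case True
    then have "level U B m = 2"
      using rise less_m by (simp add: U_eq level_greatest)
    moreover have "\<not> (\<exists>u\<in>U - B. m < u)"
      using less_m by (auto simp: U_eq dest: less_asym)
    ultimately have "star_level U B m = 1"
      by (simp add: star_level_def)
    then show ?thesis
      using True U_eq by blast
  next
    case False
    then obtain b where "b \<in> V \<inter> B" "level V B b = 1"
      using rise \<open>finite V\<close> ex_level_eq_one[of V B] by auto
    then have "level U B b = 1" "b < m"
      using less_m level_insert_greater[of b m V B] by (auto simp: U_eq less_imp_le)
    then have "star_level U B b = 1"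
      using False U_eq by (auto simp: star_level_def)
    then show ?thesis
      using \<open>b \<in> V \<inter> B\<close> U_eq by blast
  qed
qed

lemma star_level_delete_pair:
  assumes "finite U" "a \<in> U - B" "b \<in> U \<inter> B" "a < c" "c \<noteq> b"
  shows "star_level (U - {b, a}) (B - {b}) c = star_level U B c - (if c < b then 1 else 0)"
proof -
  let ?V = "{u \<in> U - {b, a}. u < c}"
  have "net_rise (B - {b}) ?V = net_rise B ?V"
    by (rule net_rise_cong) auto
  moreover have "net_rise B {u \<in> U. u < c} = net_rise B ?V + (if c < b then 1 else 0)"
  proof (cases "c < b")
    case True
    then have "{u \<in> U. u < c} = insert a ?V" using assms by auto
    then show ?thesis using True assms by (simp add: net_rise_insert)
  next
    case False
    then have "{u \<in> U. u < c} = insert a (insert b ?V)" using assms by auto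
    moreover have "a \<noteq> b" using assms by auto
    ultimately show ?thesis using False assms by (simp add: net_rise_insert)
  qed
  ultimately have "level (U - {b, a}) (B - {b}) c = level U B c - (if c < b then 1 else 0)"
    by (simp add: level_def)
  moreover have "(\<exists>u\<in>U - {b, a} - (B - {b}). c < u) \<longleftrightarrow> (\<exists>u\<in>U - B. c < u)"
    using assms by auto
  ultimately show ?thesis
    by (simp add: star_level_def)
qed

lemma star_level_after_round:
  assumes "finite U" "card U \<ge> 2" "B \<subseteq> U" "b \<in> first_B_marks U B" "c \<in> B - {b}"
  shows "star_level (after_round U b) (B - {b}) c = star_level U B c - (if c < b then 1 else 0)"
  unfolding after_round_def
proof (rule star_level_delete_pair)
  have not_B: "A_mark U b \<notin> B"
    using assms(4) by (simp add: first_B_marks_def)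
  then show "A_mark U b \<in> U - B"
    using assms(1,2) A_mark_in by auto
  have "A_mark U b \<le> c"
    using assms(1,3,5) by (auto simp: A_mark_def)
  then show "A_mark U b < c"
    using not_B assms(5) by (auto simp: less_le)
qed (use assms in \<open>auto simp: first_B_marks_def\<close>)

lemma star_level_Min:
  assumes "finite U" "B \<subset> U" "Min U \<in> B"
  shows "star_level U B (Min U) = 1"
proof -
  obtain u where "u \<in> U - B"
    using assms(2) by blast
  then have "u \<in> U - B" "Min U < u"
    using assms(1,3) by (auto simp: less_le)
  then show ?thesis
    using assms(1) by (auto simp: star_level_def level_Min)
qed

lemma star_level_A_mark_Min:
  assumes "finite U" "card U \<ge> 2" "B \<subset> U" "Min U \<in> B" "A_mark U (Min U) \<in> B"
  shows "star_level U B (A_mark U (Min U)) = 0"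
proof -
  let ?a = "A_mark U (Min U)"
  have A_mark_le: "?a \<le> u" if "u \<in> U - {Min U}" for u
    using that assms(1) by (simp add: A_mark_def)
  have "\<exists>u\<in>U - B. ?a < u"
    using A_mark_le assms(3-5) by (force simp: less_le)
  moreover have "Min U < ?a"
    using A_mark_in[OF assms(1,2), of "Min U"] assms(1) by (auto simp: less_le)
  then have "{u \<in> U. u < ?a} = {Min U}"
    using A_mark_le assms(3,4) by (blast dest: leD)
  ultimately show ?thesis
    using assms(4) by (simp add: star_level_def level_def net_rise_def)
qed

section \<open>The recursion for the product of starred heights\<close>

lemma prod_diff_prod_telescope:
  fixes f g :: "'a::linorder \<Rightarrow> 'b::comm_ring_1"
  assumes "finite B"
  shows "(\<Sum>b\<in>B. (f b - g b) * (\<Prod>c\<in>B - {b}. if c < b then g c else f c)) = prod f B - prod g B"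
  using assms
proof (induction B rule: finite_linorder_max_induct)
  case empty
  then show ?case by simp
next
  case (insert m B)
  let ?P = "\<lambda>B b. \<Prod>c\<in>B - {b}. if c < b then g c else f c"
  have "m \<notin> B" using insert.hyps by auto
  have "?P (insert m B) b = f m * ?P B b" if "b \<in> B" for b
  proof -
    have "insert m B - {b} = insert m (B - {b})" "\<not> m < b"
      using that \<open>m \<notin> B\<close> insert.hyps by auto
    then show ?thesis using \<open>m \<notin> B\<close> insert.hyps by simp
  qed
  then have "(\<Sum>b\<in>B. (f b - g b) * ?P (insert m B) b) = f m * (\<Sum>b\<in>B. (f b - g b) * ?P B b)"
    by (simp add: sum_distrib_left mult.left_commute)
  moreover have "?P (insert m B) m = prod g B"
    using \<open>m \<notin> B\<close> insert.hyps by (intro prod.cong) auto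
  ultimately have "(\<Sum>b\<in>insert m B. (f b - g b) * ?P (insert m B) b)
      = (f m - g m) * prod g B + f m * (\<Sum>b\<in>B. (f b - g b) * ?P B b)"
    using \<open>m \<notin> B\<close> insert.hyps by simp
  also have "\<dots> = f m * prod f B - g m * prod g B"
    unfolding insert.IH by (simp add: algebra_simps)
  also have "\<dots> = prod f (insert m B) - prod g (insert m B)"
    using \<open>m \<notin> B\<close> insert.hyps by simp
  finally show ?case .
qed

lemma sum_prod_lowered_star_level:
  assumes "finite U" "U \<noteq> {}" "B \<subseteq> U" "net_rise B U = 0"
  shows "(\<Sum>b\<in>B. \<Prod>c\<in>B - {b}. star_level U B c - (if c < b then 1 else 0))
    = (\<Prod>b\<in>B. star_level U B b)"
proof -
  let ?x = "star_level U B"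
  have "finite B"
    using assms(1,3) finite_subset by auto
  have lowered: "?x c - (if c < b then 1 else 0) = (if c < b then ?x c - 1 else ?x c)" for b c
    by simp
  have "(\<Sum>b\<in>B. \<Prod>c\<in>B - {b}. ?x c - (if c < b then 1 else 0))
      = (\<Sum>b\<in>B. (?x b - (?x b - 1)) * (\<Prod>c\<in>B - {b}. if c < b then ?x c - 1 else ?x c))"
    unfolding lowered by simp
  also have "\<dots> = (\<Prod>b\<in>B. ?x b) - (\<Prod>b\<in>B. ?x b - 1)"
    using \<open>finite B\<close> by (rule prod_diff_prod_telescope)
  also have "(\<Prod>b\<in>B. ?x b - 1) = 0"
    using ex_star_level_eq_one[OF assms(1,2,4)] \<open>finite B\<close> by (intro prod_zero) auto
  finally show ?thesis by simp
qed

lemma sum_first_B_marks_prod_lowered_star_level: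
  assumes "finite U" "card U \<ge> 2" "B \<subset> U" "net_rise B U = 0"
  shows "(\<Sum>b\<in>first_B_marks U B. \<Prod>c\<in>B - {b}. star_level U B c - (if c < b then 1 else 0))
    = (\<Prod>b\<in>B. star_level U B b)"
proof -
  let ?x = "star_level U B"
  have "finite B" "U \<noteq> {}"
    using assms(1,3) finite_subset by auto
  consider (up) "Min U \<notin> B"
    | (down_down) "Min U \<in> B" "A_mark U (Min U) \<in> B"
    | (down_up) "Min U \<in> B" "A_mark U (Min U) \<notin> B"
    by blast
  then show ?thesis
  proof cases
    case up
    then show ?thesis
      using sum_prod_lowered_star_level[OF assms(1) \<open>U \<noteq> {}\<close> _ assms(4)] assms(1,3) \<open>U \<noteq> {}\<close>
      by (simp add: first_B_marks_eq_self)
  next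
    case down_down
    then have "(\<Prod>b\<in>B. ?x b) = 0"
      using star_level_A_mark_Min[OF assms(1-3)] \<open>finite B\<close> by (intro prod_zero) auto
    then show ?thesis
      using down_down assms(1) \<open>U \<noteq> {}\<close> by (simp add: first_B_marks_eq_Min)
  next
    case down_up
    have "\<not> c < Min U" if "c \<in> B" for c
      using that assms(1,3) by (auto simp: not_less)
    then have "(\<Prod>c\<in>B - {Min U}. ?x c - (if c < Min U then 1 else 0)) = (\<Prod>c\<in>B - {Min U}. ?x c)"
      by (intro prod.cong) auto
    then show ?thesis
      using down_up assms(1,3) \<open>U \<noteq> {}\<close> \<open>finite B\<close>
      by (simp add: first_B_marks_eq_Min star_level_Min prod.remove[of B "Min U"])
  qed
qed

lemma prod_star_level_rec:
  assumes "finite U" "B \<subseteq> U" "card U = 2 * card B" "B \<noteq> {}"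
  shows "(\<Sum>b\<in>first_B_marks U B. \<Prod>c\<in>B - {b}. star_level (after_round U b) (B - {b}) c)
    = (\<Prod>b\<in>B. star_level U B b)"
proof -
  have "card B > 0"
    using assms finite_subset by (auto simp: card_gt_0_iff)
  then have card_U: "card U \<ge> 2" and "B \<subset> U"
    using assms(2,3) by auto
  have "(\<Sum>b\<in>first_B_marks U B. \<Prod>c\<in>B - {b}. star_level (after_round U b) (B - {b}) c)
      = (\<Sum>b\<in>first_B_marks U B. \<Prod>c\<in>B - {b}. star_level U B c - (if c < b then 1 else 0))"
    using assms(1,2) card_U by (intro sum.cong prod.cong refl star_level_after_round)
  also have "\<dots> = (\<Prod>b\<in>B. star_level U B b)"
    using assms(1-3) card_U \<open>B \<subset> U\<close>
    by (intro sum_first_B_marks_prod_lowered_star_level) (simp_all add: net_rise_eq_card)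
  finally show ?thesis .
qed

lemma crossout_count_eq_prod_star_level:
  assumes "finite U" "B \<subseteq> U" "card U = 2 * card B"
  shows "int (crossout_count U B) = (\<Prod>i=1..card B. 2 * int i - 1) * (\<Prod>b\<in>B. star_level U B b)"
  using assms
proof (induction "card B" arbitrary: U B)
  case 0
  then have "U = {}" "B = {}"
    using finite_subset by auto
  moreover have "{xs. xs = [] \<and> crossout_list xs = {}} = {[] :: 'a list}" by auto
  ultimately show ?case by (simp add: crossout_count_def)
next
  case (Suc m)
  let ?P = "\<Prod>i=1..m. 2 * int i - 1"
  have "finite B" "B \<noteq> {}"
    using Suc.prems Suc.hyps(2) finite_subset by auto
  have card_U: "card U \<ge> 2"
    using Suc.prems(3) Suc.hyps(2) by simp
  have count_after_round: "int (crossout_count (after_round U b) (B - {b}))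
      = ?P * (\<Prod>c\<in>B - {b}. star_level (after_round U b) (B - {b}) c)"
    if "b \<in> first_B_marks U B" for b
  proof -
    have b_mem: "b \<in> B" "b \<in> U" and "A_mark U b \<notin> B"
      using that Suc.prems(2) by (auto simp: first_B_marks_def)
    then have "B - {b} \<subseteq> after_round U b"
      using Suc.prems(2) by (auto simp: after_round_def)
    moreover have card_B: "card (B - {b}) = m"
      using b_mem \<open>finite B\<close> Suc.hyps(2) by simp
    moreover have "card (after_round U b) = 2 * card (B - {b})"
      using card_after_round[OF Suc.prems(1) card_U] b_mem card_B Suc.prems(3) Suc.hyps(2) by simp
    ultimately show ?thesis
      using Suc.hyps(1)[of "B - {b}" "after_round U b"] Suc.prems(1) by simp
  qed
  have "int (crossout_count U B) = (2 * int (Suc m) - 1)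
      * (\<Sum>b\<in>first_B_marks U B. int (crossout_count (after_round U b) (B - {b})))"
    using Suc.prems card_U Suc.hyps(2) by (subst crossout_count_rec) (simp_all add: of_nat_diff)
  also have "\<dots> = (2 * int (Suc m) - 1)
      * (?P * (\<Sum>b\<in>first_B_marks U B. \<Prod>c\<in>B - {b}. star_level (after_round U b) (B - {b}) c))"
    by (simp add: count_after_round sum_distrib_left)
  also have "\<dots> = (2 * int (Suc m) - 1) * (?P * (\<Prod>b\<in>B. star_level U B b))"
    using prod_star_level_rec[OF Suc.prems \<open>B \<noteq> {}\<close>] by simp
  finally show ?case
    using Suc.hyps(2)[symmetric] by (simp add: prod.nat_ivl_Suc')
qed

section \<open>Dyck paths as sets of down steps\<close>

lemma path_of_downs_eq_iff:
  assumes "D \<subseteq> {1..length p}"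
  shows "path_of_downs (length p) D = p \<longleftrightarrow> D = down_positions p"
proof
  show "D = down_positions p" if "path_of_downs (length p) D = p"
    using that down_positions_path_of_downs[OF assms] by simp
  have "path_of_downs (length p) (down_positions p) ! i = p ! i" if "i < length p" for i
    using that by (cases "p ! i") (auto simp: path_of_downs_def down_positions_def simp del: upt_Suc)
  then show "path_of_downs (length p) D = p" if "D = down_positions p"
    using that by (simp add: list_eq_iff_nth_eq)
qed

lemma path_height_Suc:
  "path_height p (Suc k) = path_height p k + (if p ! k = Up then 1 else - 1)"
  by (simp add: path_height_def)

text \<open>The step \<open>p ! b\<close> ends at \<open>b + 1\<close>: this is the shift in the definition of \<open>p_B\<close>.\<close>

definition inner_downs :: "nat \<Rightarrow> step list \<Rightarrow> nat set" where
  "inner_downs n p = {b \<in> {1..2 * n}. p ! b = Down}"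

lemma inner_downs_subset: "inner_downs n p \<subseteq> {1..2 * n}"
  by (auto simp: inner_downs_def)

lemma finite_inner_downs [simp]: "finite (inner_downs n p)"
  by (simp add: inner_downs_def)

lemma nth_eq_Up_iff_notin_inner_downs:
  assumes "b \<in> {1..2 * n}"
  shows "p ! b = Up \<longleftrightarrow> b \<notin> inner_downs n p"
  using assms by (cases "p ! b") (auto simp: inner_downs_def)

context
  fixes n :: nat and p :: "step list"
  assumes dyck: "dyck_path (n + 1) p"
begin

lemma length_dyck_path: "length p = 2 * n + 2"
  using dyck by (simp add: dyck_path_def)

lemma dyck_path_height_nonneg: "k \<le> 2 * n + 2 \<Longrightarrow> 0 \<le> path_height p k"
  using dyck by (simp add: dyck_path_def)

lemma dyck_path_height_end: "path_height p (2 * n + 2) = 0"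
  using dyck by (simp add: dyck_path_def)

lemma dyck_path_first: "p ! 0 = Up"
  using dyck_path_height_nonneg[of 1] by (auto simp: path_height_def split: if_splits)

lemma dyck_path_last: "p ! (2 * n + 1) = Down"
  using dyck_path_height_nonneg[of "2 * n + 1"] dyck_path_height_end path_height_Suc[of p "2 * n + 1"]
  by (cases "p ! (2 * n + 1)") auto

lemma path_height_eq_level:
  assumes "1 \<le> k" "k \<le> 2 * n + 1"
  shows "path_height p k = level {1..2 * n} (inner_downs n p) k"
proof -
  have "{..<k} = insert 0 {u \<in> {1..2 * n}. u < k}"
    using assms by auto
  then have "path_height p k = 1 + (\<Sum>j\<in>{u \<in> {1..2 * n}. u < k}. if p ! j = Up then 1 else - 1)"
    using dyck_path_first by (simp add: path_height_def)
  also have "(\<Sum>j\<in>{u \<in> {1..2 * n}. u < k}. if p ! j = Up then 1 else - 1)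
      = net_rise (inner_downs n p) {u \<in> {1..2 * n}. u < k}"
    unfolding net_rise_def by (intro sum.cong) (auto simp: nth_eq_Up_iff_notin_inner_downs)
  finally show ?thesis by (simp add: level_def)
qed

lemma card_inner_downs: "card (inner_downs n p) = n"
proof -
  have "{u \<in> {1..2 * n}. u < 2 * n + 1} = {1..2 * n}" by auto
  then have "1 + net_rise (inner_downs n p) {1..2 * n} = path_height p (2 * n + 1)"
    using path_height_eq_level[of "2 * n + 1"] by (simp add: level_def)
  also have "\<dots> = 1"
    using dyck_path_height_end path_height_Suc[of p "2 * n + 1"] dyck_path_last by simp
  finally show ?thesis
    using inner_downs_subset by (simp add: net_rise_eq_card)
qed

lemma down_positions_eq_insert: "down_positions p = insert (2 * n + 2) (Suc ` inner_downs n p)"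
proof (intro equalityI subsetI)
  fix k assume "k \<in> down_positions p"
  then have k_Down: "1 \<le> k" "k \<le> 2 * n + 2" "p ! (k - 1) = Down"
    using length_dyck_path by (auto simp: down_positions_def)
  then have "k \<noteq> 1" using dyck_path_first by auto
  then have "k = 2 * n + 2 \<or> k - 1 \<in> inner_downs n p \<and> k = Suc (k - 1)"
    using k_Down by (auto simp: inner_downs_def)
  then show "k \<in> insert (2 * n + 2) (Suc ` inner_downs n p)" by blast
next
  fix k assume "k \<in> insert (2 * n + 2) (Suc ` inner_downs n p)"
  then show "k \<in> down_positions p"
    using length_dyck_path dyck_path_last by (auto simp: down_positions_def inner_downs_def)
qed

lemma p_B_eq_iff: "p_B n w = p \<longleftrightarrow> B_set n w = inner_downs n p"
proof -
  have B_set_subset: "B_set n w \<subseteq> {1..2 * n}"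
    using crossout_B_subset by (simp add: B_set_def)
  then have "insert (2 * n + 2) (Suc ` B_set n w) \<subseteq> {1..length p}"
    by (auto simp: length_dyck_path)
  moreover have "p_B n w = path_of_downs (length p) (insert (2 * n + 2) (Suc ` B_set n w))"
    by (simp add: p_B_def length_dyck_path)
  ultimately have "p_B n w = p \<longleftrightarrow> insert (2 * n + 2) (Suc ` B_set n w) = down_positions p"
    by (simp only: path_of_downs_eq_iff)
  also have "\<dots> \<longleftrightarrow> Suc ` B_set n w = Suc ` inner_downs n p"
    unfolding down_positions_eq_insert using B_set_subset inner_downs_subset[of n p]
    by (intro insert_ident) auto
  finally show ?thesis
    by (simp add: inj_image_eq_iff)
qed

lemma bij_betw_down_pos: "bij_betw (down_pos p) {1..n} (Suc ` inner_downs n p)"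
proof -
  let ?ds = "sorted_list_of_set (Suc ` inner_downs n p)"
  have length_ds: "length ?ds = n"
    by (simp add: card_image card_inner_downs)
  have "sorted_list_of_set (down_positions p) = insort (2 * n + 2) ?ds"
    unfolding down_positions_eq_insert using inner_downs_subset[of n p]
    by (intro sorted_list_of_set_insert) auto
  also have "\<dots> = ?ds @ [2 * n + 2]"
    using inner_downs_subset[of n p] by (intro sorted_insort_is_snoc) auto
  finally have "down_pos p i = ?ds ! (i - 1)" if "i \<in> {1..n}" for i
    using that length_ds by (auto simp: down_pos_def nth_append)
  moreover have "bij_betw ((!) ?ds \<circ> (\<lambda>i. i - 1)) {1..n} (Suc ` inner_downs n p)"
  proof (rule bij_betw_trans)
    show "bij_betw (\<lambda>i. i - 1) {1..n} {..<n}"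
      by (rule bij_betwI[of _ _ _ Suc]) auto
    show "bij_betw ((!) ?ds) {..<n} (Suc ` inner_downs n p)"
      using length_ds by (intro bij_betw_nth) auto
  qed
  ultimately show ?thesis
    by (subst bij_betw_cong[of _ _ "(!) ?ds \<circ> (\<lambda>i. i - 1)"]) auto
qed

lemma ex_later_Up_iff:
  assumes "b \<in> inner_downs n p"
  shows "(\<exists>k\<in>{1..length p}. Suc b < k \<and> p ! (k - 1) = Up) \<longleftrightarrow>
    (\<exists>u\<in>{1..2 * n} - inner_downs n p. b < u)"
proof
  assume "\<exists>k\<in>{1..length p}. Suc b < k \<and> p ! (k - 1) = Up"
  then obtain k where k_Up: "k \<le> 2 * n + 2" "Suc b < k" "p ! (k - 1) = Up"
    using length_dyck_path by auto
  then have "k \<noteq> 2 * n + 2" using dyck_path_last by auto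
  then have "k - 1 \<in> {1..2 * n}" using k_Up by auto
  then show "\<exists>u\<in>{1..2 * n} - inner_downs n p. b < u"
    using k_Up nth_eq_Up_iff_notin_inner_downs by (intro bexI[of _ "k - 1"]) auto
next
  assume "\<exists>u\<in>{1..2 * n} - inner_downs n p. b < u"
  then obtain u where "u \<in> {1..2 * n}" "u \<notin> inner_downs n p" "b < u" by auto
  then show "\<exists>k\<in>{1..length p}. Suc b < k \<and> p ! (k - 1) = Up"
    using nth_eq_Up_iff_notin_inner_downs length_dyck_path by (intro bexI[of _ "Suc u"]) auto
qed

lemma down_height_star_eq_star_level:
  assumes "b \<in> inner_downs n p" "down_pos p i = Suc b"
  shows "down_height_star p i = star_level {1..2 * n} (inner_downs n p) b"
proof -
  have "1 \<le> b" "b \<le> 2 * n + 1"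
    using assms(1) inner_downs_subset[of n p] by auto
  then show ?thesis
    using ex_later_Up_iff[OF assms(1)] assms(2)
    by (simp add: down_height_star_def down_height_def star_level_def path_height_eq_level)
qed

lemma prod_down_height_star:
  "(\<Prod>i=1..n. down_height_star p i)
    = (\<Prod>b\<in>inner_downs n p. star_level {1..2 * n} (inner_downs n p) b)"
proof -
  let ?star = "star_level {1..2 * n} (inner_downs n p)"
  have "down_height_star p i = ?star (down_pos p i - 1)" if i: "i \<in> {1..n}" for i
  proof -
    obtain b where "b \<in> inner_downs n p" "down_pos p i = Suc b"
      using bij_betw_apply[OF bij_betw_down_pos i] by blast
    then show ?thesis
      using down_height_star_eq_star_level by simp
  qed
  then have "(\<Prod>i=1..n. down_height_star p i) = (\<Prod>i=1..n. ?star (down_pos p i - 1))"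
    by (intro prod.cong) auto
  also have "\<dots> = (\<Prod>d\<in>Suc ` inner_downs n p. ?star (d - 1))"
    by (rule prod.reindex_bij_betw[OF bij_betw_down_pos])
  also have "\<dots> = (\<Prod>b\<in>inner_downs n p. ?star b)"
    by (simp add: prod.reindex)
  finally show ?thesis .
qed

end

theorem theorem4:
  fixes n :: nat and \<beta> :: "step list"
  assumes "n \<ge> 1" and "dyck_path (n + 1) \<beta>"
  shows "int (card {w. w permutes {1..2 * n} \<and> p_B n w = \<beta>})
           = (\<Prod>i=1..n. 2 * int i - 1) * (\<Prod>i=1..n. down_height_star \<beta> i)"
proof -
  let ?U = "{1..2 * n}" and ?B = "inner_downs n \<beta>"
  have card_B: "card ?B = n"
    using assms(2) by (rule card_inner_downs)
  have "card {w. w permutes ?U \<and> p_B n w = \<beta>} = card {w. w permutes ?U \<and> B_set n w = ?B}"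
    by (simp only: p_B_eq_iff[OF assms(2)])
  also have "\<dots> = crossout_count ?U ?B"
    by (rule card_permutes_B_set)
  also have "int \<dots> = (\<Prod>i=1..n. 2 * int i - 1) * (\<Prod>b\<in>?B. star_level ?U ?B b)"
    using crossout_count_eq_prod_star_level[of ?U ?B] inner_downs_subset card_B by simp
  also have "(\<Prod>b\<in>?B. star_level ?U ?B b) = (\<Prod>i=1..n. down_height_star \<beta> i)"
    by (rule prod_down_height_star[OF assms(2), symmetric])
  finally show ?thesis .
qed

end
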